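(* Let $\alpha<1$ be real, let $f(z)=z+\sum_{n=2}^{\infty}a_nz^n\in H\mathcal{K}(\alpha)$, and let $\lambda\in\mathbb{R}$. Then for all integers $n,m\ge 2$, $$|\lambda a_na_m-a_{n+m-1}|\le\begin{cases}\dfrac{A_{n+m-1}}{n+m-1}, & 0\le\lambda\le \dfrac{2nmA_{n+m-1}}{(n+m-1)A_nA_m},\\[3mm] \left|\lambda \dfrac{A_nA_m}{nm}-\dfrac{A_{n+m-1}}{n+m-1}\right|, & \text{for all other real } \lambda,\end{cases}$$ where $A_n=\frac{1}{(n-1)!}\prod_{j=0}^{n-2}\big(2(1-\alpha)+j\big)$ for $n\ge2$. The second inequality is sharp: equality in it is attained by the function $f_2$ and by its rotations, where $$f_2(z)=\begin{cases}\dfrac{(1-z)^{-(1-2\alpha)}-1}{1-2\alpha}, & \alpha\ne 1/2,\\[2mm] -\log(1-z), & \alpha=1/2.\end{cases}$$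
   Context: $\mathbb{D}$ is the open unit disc and $\mathcal{A}$ is the class of analytic functions on $\mathbb{D}$ of the form $f(z)=z+a_2z^2+a_3z^3+\cdots$. For real $\alpha<1$, $\mathcal{K}(\alpha)$ is the class of $f\in\mathcal{A}$ with $\operatorname{Re}\big(1+zf''(z)/f'(z)\big)>\alpha$ on $\mathbb{D}$. $H\mathcal{K}(\alpha)$ is the closed convex hull of $\mathcal{K}(\alpha)$ (closure in the topology of uniform convergence on compact subsets of $\mathbb{D}$). Powers and logarithms of $1-z$ are taken with the branches equal to $1$, respectively $0$, at $z=0$. The rotations of $f\in\mathcal{A}$ are the functions $z\mapsto e^{-i\theta}f(e^{i\theta}z)$, $\theta\in\mathbb{R}$. *)

theory Defs
  imports "HOL-Complex_Analysis.Complex_Analysis"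
begin

text \<open>
  Functions on the open unit disc are represented by total functions on the complex numbers;
  no notion below depends on values outside \<^term>\<open>ball (0::complex) 1\<close>.
\<close>

definition has_expansion :: "(complex \<Rightarrow> complex) \<Rightarrow> (nat \<Rightarrow> complex) \<Rightarrow> bool" where
  "has_expansion f a \<longleftrightarrow>
     (\<forall>z\<in>ball 0 1. (\<lambda>n. a (n + 2) * z ^ (n + 2)) sums (f z - z))"

definition class_A :: "(complex \<Rightarrow> complex) set" where
  "class_A = {f. f holomorphic_on ball 0 1 \<and> (\<exists>a. has_expansion f a)}"

text \<open>
  The condition \<^term>\<open>deriv f z \<noteq> 0\<close> is implicit in the quotient \<open>f'' / f'\<close>;
  it is spelled out because division by zero yields zero here.
\<close>

definition class_K :: "real \<Rightarrow> (complex \<Rightarrow> complex) set" where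
  "class_K \<alpha> = {f \<in> class_A. \<forall>z\<in>ball 0 1.
     deriv f z \<noteq> 0 \<and> Re (1 + z * deriv (deriv f) z / deriv f z) > \<alpha>}"

text \<open>
  The topology of uniform convergence on compact subsets of the disc, on the space of
  holomorphic functions on the disc, given by its standard basis.
\<close>

definition compact_convergence :: "(complex \<Rightarrow> complex) topology" where
  "compact_convergence = topology_generated_by
     {{g. g holomorphic_on ball 0 1 \<and> (\<forall>z\<in>C. dist (g z) (f z) < e)} | f C e.
        f holomorphic_on ball 0 1 \<and> compact C \<and> C \<subseteq> ball 0 1 \<and> e > 0}"

text \<open>The library's \<^const>\<open>convex\<close> is not available for functions (no vector space instance).\<close>

definition fun_convex_hull :: "(complex \<Rightarrow> complex) set \<Rightarrow> (complex \<Rightarrow> complex) set" where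
  "fun_convex_hull S =
     {(\<lambda>z. \<Sum>i<k. of_real (t i) * g i z) | (k::nat) (t :: nat \<Rightarrow> real) g.
        (\<forall>i<k. 0 \<le> t i \<and> g i \<in> S) \<and> (\<Sum>i<k. t i) = 1}"

definition class_HK :: "real \<Rightarrow> (complex \<Rightarrow> complex) set" where
  "class_HK \<alpha> = compact_convergence closure_of fun_convex_hull (class_K \<alpha>)"

definition A_coeff :: "real \<Rightarrow> nat \<Rightarrow> real" where
  "A_coeff \<alpha> n = (\<Prod>j<n - 1. 2 * (1 - \<alpha>) + real j) / fact (n - 1)"

text \<open>
  On the disc \<open>1 - z\<close> lies in the right half-plane, so the principal branches used by
  \<^const>\<open>Ln\<close> and \<open>powr\<close> are the ones normalised at \<open>z = 0\<close>.
\<close>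

definition f2 :: "real \<Rightarrow> complex \<Rightarrow> complex" where
  "f2 \<alpha> z = (if \<alpha> \<noteq> 1 / 2
     then ((1 - z) powr of_real (- (1 - 2 * \<alpha>)) - 1) / of_real (1 - 2 * \<alpha>)
     else - Ln (1 - z))"

definition rotation :: "real \<Rightarrow> (complex \<Rightarrow> complex) \<Rightarrow> complex \<Rightarrow> complex" where
  "rotation \<theta> f z = exp (- \<i> * of_real \<theta>) * f (exp (\<i> * of_real \<theta>) * z)"

end

theory Submission
  imports Defs
begin

text \<open>
  Put \<open>s = 2 * (1 - \<alpha>)\<close>, so that \<open>A\<^sub>n\<close> is the coefficient of \<open>z ^ (n - 1)\<close> in \<open>(1 - z) powr (- s)\<close>. The heart
  of the matter is that the numbers \<open>n * a\<^sub>n / A\<^sub>n\<close>, indexed by \<open>n - 1\<close>, are the moments \<open>c\<close> of a probability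
  measure on the closed unit disc, whenever \<open>f\<close> lies in the closed convex hull. Equivalently, \<open>f'\<close> is
  an average of the functions \<open>(1 - x * z) powr (- s)\<close> with \<open>\<bar>x\<bar> \<le> 1\<close>. Moment sequences form a convex set
  that is closed under pointwise limits, so the passage from the class to its closed convex hull is routine
  (\<open>class_HK_disc_moments\<close>) and only the class itself needs an argument (\<open>class_K_disc_moments\<close>).

  For \<open>f\<close> in the class, \<open>z * f'' / f' = (1 - \<alpha>) * (p - 1)\<close> with \<open>Re p > 0\<close>. Beyond the constant term the coefficients
  of \<open>p\<close> are twice the moments of a probability measure (\<open>caratheodory_disc_moments\<close>), and integrating the equation shows
  that \<open>f'\<close> is a product, over that measure, of powers of \<open>1 - x * z\<close> with total exponent \<open>- s\<close>. Such a
  product is an average of powers \<open>(1 - w * z) powr (- s)\<close>: for two factors with exponents \<open>- a\<close> and \<open>- b\<close>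
  the point \<open>w\<close> is a Beta-distributed random convex combination of the two points
  (\<open>pochhammer_fps_mult\<close>), and the general case is a limit of \<open>K\<close>-th powers of averages with
  exponent \<open>- s / K\<close> (\<open>disc_moments_exponential\<close>). Convex combinations of points of the circle lie inside
  the disc, so measures on the disc, not only those on the circle, are the natural setting.

  In terms of the moments the functional is \<open>- Y * (c (j + k) - \<nu> * c j * c k)\<close>, where \<open>j = n - 1\<close>,
  \<open>k = m - 1\<close>, \<open>Y = A\<^sub>n\<^sub>+\<^sub>m\<^sub>-\<^sub>1 / (n + m - 1)\<close> and \<open>\<nu>\<close> is \<open>\<mu>\<close> rescaled so that the threshold is \<open>\<nu> = 2\<close>.
  Cauchy--Schwarz bounds it by \<open>Y * max 1 \<bar>1 - \<nu>\<bar>\<close> (\<open>disc_moments_product_bound\<close>). A unit mass at a point of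
  the circle gives the value \<open>Y * \<bar>1 - \<nu>\<bar>\<close>, and the unit masses on the circle belong to the rotations
  of \<open>f2 \<alpha>\<close>.
\<close>

section \<open>Moment sequences of the unit disc\<close>

text \<open>
  By Hahn--Banach and Riesz these are the sequences of moments of probability measures on the closed
  unit disc. The dual description is the one to work with: convexity and closedness under pointwise
  limits are immediate, a product of two such conditions can be handled one factor at a time, and no
  measure ever has to be constructed.
\<close>

definition disc_moments :: "(nat \<Rightarrow> complex) set" where
  "disc_moments = {c. c 0 = 1 \<and>
     (\<forall>N \<tau>. (\<forall>x. cmod x \<le> 1 \<longrightarrow> 0 \<le> Re (\<Sum>i\<le>N. \<tau> i * x ^ i)) \<longrightarrow>
            0 \<le> Re (\<Sum>i\<le>N. \<tau> i * c i))}"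

lemma disc_moments_0: "c \<in> disc_moments \<Longrightarrow> c 0 = 1"
  by (simp add: disc_moments_def)

lemma disc_moments_nonneg:
  assumes "c \<in> disc_moments"
    and "\<And>x. cmod x \<le> 1 \<Longrightarrow> 0 \<le> Re (\<Sum>i\<le>N. \<tau> i * x ^ i)"
  shows "0 \<le> Re (\<Sum>i\<le>N. \<tau> i * c i)"
  using assms unfolding disc_moments_def by blast

lemma disc_momentsI:
  assumes "c 0 = 1"
    and "\<And>N \<tau>. (\<And>x. cmod x \<le> 1 \<Longrightarrow> 0 \<le> Re (\<Sum>i\<le>N. \<tau> i * x ^ i)) \<Longrightarrow>
               0 \<le> Re (\<Sum>i\<le>N. \<tau> i * c i)"
  shows "c \<in> disc_moments"
  using assms unfolding disc_moments_def by blast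

lemma disc_moments_convex:
  fixes t :: "nat \<Rightarrow> real"
  assumes "\<And>l. l < k \<Longrightarrow> 0 \<le> t l" and "(\<Sum>l<k. t l) = 1"
    and "\<And>l. l < k \<Longrightarrow> c l \<in> disc_moments"
  shows "(\<lambda>n. \<Sum>l<k. of_real (t l) * c l n) \<in> disc_moments"
proof (rule disc_momentsI)
  have "(\<Sum>l<k. of_real (t l) * c l 0) = of_real (\<Sum>l<k. t l)"
    unfolding of_real_sum by (intro sum.cong) (auto simp: disc_moments_0 assms(3))
  then show "(\<Sum>l<k. of_real (t l) * c l 0) = 1" by (simp add: assms(2))
next
  fix N \<tau> assume nonneg: "\<And>x. cmod x \<le> 1 \<Longrightarrow> 0 \<le> Re (\<Sum>i\<le>N. \<tau> i * x ^ i)"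
  have "(\<Sum>i\<le>N. \<tau> i * (\<Sum>l<k. of_real (t l) * c l i))
      = (\<Sum>l<k. of_real (t l) * (\<Sum>i\<le>N. \<tau> i * c l i))"
    unfolding sum_distrib_left by (subst sum.swap) (simp add: mult_ac)
  moreover have "0 \<le> (\<Sum>l<k. t l * Re (\<Sum>i\<le>N. \<tau> i * c l i))"
    by (intro sum_nonneg mult_nonneg_nonneg disc_moments_nonneg[OF assms(3)] assms(1) nonneg) simp_all
  ultimately show "0 \<le> Re (\<Sum>i\<le>N. \<tau> i * (\<Sum>l<k. of_real (t l) * c l i))"
    by simp
qed

lemma disc_moments_limit:
  assumes "\<And>l. c l \<in> disc_moments" and lim: "\<And>n. (\<lambda>l. c l n) \<longlonglongrightarrow> d n"
  shows "d \<in> disc_moments"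
proof (rule disc_momentsI)
  have "(\<lambda>l. c l 0) \<longlonglongrightarrow> 1" using assms(1) by (simp add: disc_moments_0)
  with lim show "d 0 = 1" by (rule LIMSEQ_unique)
next
  fix N \<tau> assume nonneg: "\<And>x. cmod x \<le> 1 \<Longrightarrow> 0 \<le> Re (\<Sum>i\<le>N. \<tau> i * x ^ i)"
  have "(\<lambda>l. Re (\<Sum>i\<le>N. \<tau> i * c l i)) \<longlonglongrightarrow> Re (\<Sum>i\<le>N. \<tau> i * d i)"
    by (intro tendsto_intros lim)
  then show "0 \<le> Re (\<Sum>i\<le>N. \<tau> i * d i)"
    by (rule LIMSEQ_le_const) (intro exI[of _ 0] allI impI disc_moments_nonneg[OF assms(1)] nonneg)
qed

text \<open>
  The estimates below only test a moment sequence against \<open>1\<close>, \<open>x ^ k\<close>, \<open>x ^ j\<close> and \<open>x ^ (j + k)\<close>.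
  The indices \<open>0\<close>, \<open>j\<close>, \<open>k\<close>, \<open>j + k\<close> may coincide, so the test polynomial is a sum of four monomials
  rather than a case distinction on the index.
\<close>

lemma disc_moments_four_terms:
  fixes A \<beta> \<gamma> \<delta> :: complex
  assumes "c \<in> disc_moments"
    and pos: "\<And>x. cmod x \<le> 1 \<Longrightarrow> 0 \<le> Re (A + \<beta> * x ^ k + \<gamma> * x ^ j + \<delta> * x ^ (j + k))"
  shows "0 \<le> Re (A + \<beta> * c k + \<gamma> * c j + \<delta> * c (j + k))"
proof -
  define \<tau> where "\<tau> i = (if i = 0 then A else 0) + (if i = k then \<beta> else 0)
      + (if i = j then \<gamma> else 0) + (if i = j + k then \<delta> else 0)" for i
  have *: "(\<Sum>i\<le>j + k. \<tau> i * d i) = A * d 0 + \<beta> * d k + \<gamma> * d j + \<delta> * d (j + k)"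
    for d :: "nat \<Rightarrow> complex"
  proof -
    have "\<tau> i * d i = (if i = 0 then A * d 0 else 0) + (if i = k then \<beta> * d k else 0)
        + (if i = j then \<gamma> * d j else 0) + (if i = j + k then \<delta> * d (j + k) else 0)" for i
      unfolding \<tau>_def distrib_right by (intro arg_cong2[where f = "(+)"]) auto
    then show ?thesis by (simp add: sum.distrib)
  qed
  have "0 \<le> Re (\<Sum>i\<le>j + k. \<tau> i * c i)"
  proof (rule disc_moments_nonneg[OF assms(1)])
    fix x :: complex assume "cmod x \<le> 1"
    from pos[OF this] show "0 \<le> Re (\<Sum>i\<le>j + k. \<tau> i * x ^ i)"
      unfolding * by (simp only: power_0 mult_1_right)
  qed
  then show ?thesis unfolding * disc_moments_0[OF assms(1)] by (simp only: mult_1_right)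
qed

lemma obtain_rotation_to_cmod:
  obtains u where "cmod u = 1" and "u * z = of_real (cmod z)"
proof (cases "z = 0")
  case True
  then show ?thesis by (intro that[of 1]) auto
next
  case False
  then show ?thesis
    by (intro that[of "cnj z / cmod z"])
       (auto simp: norm_divide field_simps complex_norm_square[symmetric] power2_eq_square)
qed

lemma disc_moments_cmod_le_1:
  assumes "c \<in> disc_moments"
  shows "cmod (c k) \<le> 1"
proof -
  obtain u where u: "cmod u = 1" "u * c k = of_real (cmod (c k))"
    by (rule obtain_rotation_to_cmod)
  have "0 \<le> Re (1 + (- u) * c k + 0 * c 0 + 0 * c (0 + k))"
  proof (rule disc_moments_four_terms[OF assms])
    fix x :: complex assume "cmod x \<le> 1"
    then have "Re (u * x ^ k) \<le> 1"
      using complex_Re_le_cmod[of "u * x ^ k"] power_le_one[of "cmod x" k]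
      by (simp add: norm_mult norm_power u)
    then show "0 \<le> Re (1 + (- u) * x ^ k + 0 * x ^ 0 + 0 * x ^ (0 + k))" by simp
  qed
  then show ?thesis using u by simp
qed

text \<open>
  For a measure with moments \<open>c\<close> and \<open>\<kappa> = c k\<close>, the left-hand side is the modulus of the integral of
  \<open>x ^ j * (x ^ k - \<nu> * \<kappa>)\<close>, so by Cauchy--Schwarz its square is at most the integral of
  \<open>\<bar>x ^ k - \<nu> * \<kappa>\<bar>\<^sup>2\<close>, that is at most \<open>1 + (\<nu>\<^sup>2 - 2 * \<nu>) * \<bar>\<kappa>\<bar>\<^sup>2\<close>. This is a convex combination of \<open>1\<close> and
  \<open>(1 - \<nu>)\<^sup>2\<close> because \<open>\<bar>\<kappa>\<bar> \<le> 1\<close>. In the dual description Cauchy--Schwarz is replaced by its pointwise form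
  \<open>R * \<bar>d\<bar> \<le> (R\<^sup>2 + \<bar>d\<bar>\<^sup>2) / 2\<close>, for \<open>R\<close> the asserted bound and \<open>d = x ^ k - \<nu> * \<kappa>\<close>, which turns the argument into a single test polynomial.
\<close>

lemma disc_moments_product_bound:
  fixes \<nu> :: real
  assumes c: "c \<in> disc_moments"
  shows "cmod (c (j + k) - of_real \<nu> * c j * c k) \<le> max 1 \<bar>1 - \<nu>\<bar>"
proof -
  define \<kappa> where "\<kappa> = c k"
  define R where "R = max 1 \<bar>1 - \<nu>\<bar>"
  define w where "w = c (j + k) - of_real \<nu> * \<kappa> * c j"
  have R: "R \<ge> 1" "\<bar>1 - \<nu>\<bar> \<le> R" unfolding R_def by simp_all
  then have R2: "R\<^sup>2 \<ge> 1" "R\<^sup>2 \<ge> (1 - \<nu>)\<^sup>2"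
    by (simp_all only: one_le_power power2_le_iff_abs_le)
  obtain u where u: "cmod u = 1" "u * w = of_real (cmod w)"
    by (rule obtain_rotation_to_cmod)
  have Re_scale: "Re (of_real r * z) = r * Re z" for r z by simp
  define A where "A = (R\<^sup>2 + 1 + \<nu>\<^sup>2 * (cmod \<kappa>)\<^sup>2) / 2"
  \<comment> \<open>The real part is \<open>A - R * Re (u * x ^ j * d) - \<nu> * Re (cnj \<kappa> * x ^ k)\<close> at a point \<open>x\<close>, where
    \<open>d = x ^ k - \<nu> * \<kappa>\<close>, and \<open>A - R * cmod w - \<nu> * (cmod \<kappa>)\<^sup>2\<close> at the sequence \<open>c\<close>.\<close>
  have "0 \<le> Re (of_real A + (- of_real \<nu> * cnj \<kappa>) * c k
                 + (of_real R * u * of_real \<nu> * \<kappa>) * c j + (- of_real R * u) * c (j + k))"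
  proof (rule disc_moments_four_terms[OF c])
    fix x :: complex assume x: "cmod x \<le> 1"
    define y where "y = x ^ k"
    define d where "d = y - of_real \<nu> * \<kappa>"
    have y: "cmod y \<le> 1" using x by (simp add: y_def norm_power power_le_one)
    have "(cmod d)\<^sup>2 = (cmod y)\<^sup>2 - 2 * \<nu> * Re (cnj \<kappa> * y) + \<nu>\<^sup>2 * (cmod \<kappa>)\<^sup>2"
      unfolding d_def cmod_power2 by (simp add: power2_eq_square algebra_simps)
    moreover have "(cmod y)\<^sup>2 \<le> 1" using y by (simp add: power_le_one)
    moreover have "R * cmod d \<le> (R\<^sup>2 + (cmod d)\<^sup>2) / 2"
      using sum_squares_bound[of R "cmod d"] by simp
    moreover have "Re (of_real R * u * x ^ j * d) \<le> R * cmod d"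
    proof -
      have "Re (of_real R * u * x ^ j * d) \<le> cmod (of_real R * u * x ^ j * d)"
        by (rule complex_Re_le_cmod)
      also have "\<dots> = R * cmod d * cmod x ^ j" using R u by (simp add: norm_mult norm_power)
      also have "\<dots> \<le> R * cmod d"
        using R x by (intro mult_left_le) (auto simp: power_le_one)
      finally show ?thesis .
    qed
    ultimately have "Re (of_real R * u * x ^ j * d) + \<nu> * Re (cnj \<kappa> * y) \<le> A"
      by (simp add: A_def)
    moreover have "of_real A + (- of_real \<nu> * cnj \<kappa>) * x ^ k + (of_real R * u * of_real \<nu> * \<kappa>) * x ^ j
        + (- of_real R * u) * x ^ (j + k)
      = of_real A - of_real R * u * x ^ j * d - of_real \<nu> * (cnj \<kappa> * y)"
      unfolding d_def y_def power_add by algebra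
    ultimately show "0 \<le> Re (of_real A + (- of_real \<nu> * cnj \<kappa>) * x ^ k
        + (of_real R * u * of_real \<nu> * \<kappa>) * x ^ j + (- of_real R * u) * x ^ (j + k))"
      by (simp only: minus_complex.sel Re_complex_of_real Re_scale)
  qed
  also have "of_real A + (- of_real \<nu> * cnj \<kappa>) * c k
        + (of_real R * u * of_real \<nu> * \<kappa>) * c j + (- of_real R * u) * c (j + k)
      = of_real A - of_real \<nu> * (\<kappa> * cnj \<kappa>) - of_real R * (u * w)"
    unfolding w_def \<kappa>_def by algebra
  also have "\<dots> = of_real (A - \<nu> * (cmod \<kappa>)\<^sup>2 - R * cmod w)"
    by (simp add: u complex_norm_square[symmetric])
  finally have "R * cmod w \<le> A - \<nu> * (cmod \<kappa>)\<^sup>2" by simp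
  also have "\<dots> \<le> R * R"
  proof -
    have t: "0 \<le> (cmod \<kappa>)\<^sup>2" "(cmod \<kappa>)\<^sup>2 \<le> 1"
      using disc_moments_cmod_le_1[OF c, of k] by (auto simp: \<kappa>_def power_le_one)
    have "(1 - (cmod \<kappa>)\<^sup>2) * 1 + (cmod \<kappa>)\<^sup>2 * (1 - \<nu>)\<^sup>2 \<le> R\<^sup>2"
      by (rule convex_bound_le) (use t R2 in auto)
    then show ?thesis by (simp add: A_def power2_eq_square algebra_simps)
  qed
  finally have "cmod w \<le> R" using R by simp
  then show ?thesis by (simp add: w_def R_def \<kappa>_def mult_ac)
qed

lemma zero_le_mult_pos: "0 \<le> x * y \<Longrightarrow> 0 < x \<Longrightarrow> 0 \<le> y" for x y :: real
  by (simp add: zero_le_mult_iff)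

section \<open>Functions with positive real part\<close>

text \<open>
  A probabilistic form of the Herglotz representation. On the circle of radius \<open>r < 1\<close> the product of
  the nonnegative functions \<open>Re (p u)\<close> and \<open>Re (T (r / u))\<close>, with \<open>T\<close> the test polynomial, has a
  nonnegative mean. Since \<open>cnj (T (r / u))\<close> is again a polynomial in \<open>u\<close> on that circle, the mean of
  \<open>p u * Re (T (r / u))\<close> is given by Cauchy's formulas, and it is the test sum with the coefficients
  weighted by \<open>r ^ i\<close>. Letting \<open>r\<close> tend to \<open>1\<close> finishes the proof. The factor \<open>1 / 2\<close> for \<open>n > 0\<close>
  reflects the kernel \<open>(1 + x * z) / (1 - x * z) = 1 + 2 * (x * z + (x * z)\<^sup>2 + \<dots>)\<close>.
\<close>

lemma caratheodory_disc_moments: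
  assumes holo: "p holomorphic_on ball 0 1"
    and pos: "\<And>z. z \<in> ball 0 1 \<Longrightarrow> 0 \<le> Re (p z)" and p0: "p 0 = 1"
  shows "(\<lambda>n. if n = 0 then 1 else (deriv ^^ n) p 0 / (2 * fact n)) \<in> disc_moments"
proof (rule disc_momentsI)
  define c where "c = (\<lambda>n. if n = 0 then 1 else (deriv ^^ n) p 0 / (2 * fact n))"
  fix N \<tau> assume nonneg: "\<And>x. cmod x \<le> 1 \<Longrightarrow> 0 \<le> Re (\<Sum>i\<le>N. \<tau> i * x ^ i)"
  define T where "T x = (\<Sum>i\<le>N. \<tau> i * x ^ i)" for x
  have inner: "0 \<le> Re (\<Sum>i\<le>N. \<tau> i * of_real r ^ i * c i)" if r: "0 < r" "r < 1" for r
  proof -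
    define q where "q = (\<lambda>n. (deriv ^^ n) p 0 / fact n)"
    define S where "S u = (\<Sum>i\<le>N. cnj (\<tau> i) * (u / of_real r) ^ i)" for u
    \<comment> \<open>On the circle of radius \<open>r\<close>, \<open>F u = 2 * p u * Re (T (r / u)) / u\<close>; the present form is meromorphic
      with its only pole at \<open>0\<close>. The trivial \<open>u - 0\<close> matches Cauchy's formula for derivatives.\<close>
    define F where "F u = (\<Sum>i\<le>N. \<tau> i * of_real r ^ i * (p u / (u - 0) ^ Suc i))
        + p u * S u / (u - 0) ^ Suc 0" for u
    have sub: "cball (0::complex) r \<subseteq> ball 0 1" "ball (0::complex) r \<subseteq> ball 0 1"
      using r by auto
    have pS: "(\<lambda>u. p u * S u) holomorphic_on ball 0 1"
      unfolding S_def using r by (intro holomorphic_intros holo) auto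
    have "(F has_contour_integral ((\<Sum>i\<le>N. \<tau> i * of_real r ^ i *
              ((2 * pi * \<i>) / fact i * (deriv ^^ i) p 0))
            + (2 * pi * \<i>) / fact 0 * (deriv ^^ 0) (\<lambda>u. p u * S u) 0)) (circlepath 0 r)"
      unfolding F_def using r sub
      by (intro has_contour_integral_add has_contour_integral_sum has_contour_integral_lmul
            Cauchy_has_contour_integral_higher_derivative_circlepath
            holomorphic_on_imp_continuous_on holomorphic_on_subset[OF holo]
            holomorphic_on_subset[OF pS]) auto
    also have "(\<Sum>i\<le>N. \<tau> i * of_real r ^ i * ((2 * pi * \<i>) / fact i * (deriv ^^ i) p 0))
        = 2 * pi * \<i> * (\<Sum>i\<le>N. \<tau> i * of_real r ^ i * q i)"
      unfolding sum_distrib_left q_def by (intro sum.cong) (auto simp: mult_ac)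
    also have "S 0 = cnj (\<tau> 0)"
      unfolding S_def by (simp add: power_0_left if_distrib cong: if_cong)
    then have "(2 * pi * \<i>) / fact 0 * (deriv ^^ 0) (\<lambda>u. p u * S u) 0 = 2 * pi * \<i> * cnj (\<tau> 0)"
      by (simp add: p0)
    finally have "((\<lambda>t. F (circlepath 0 r t) * vector_derivative (circlepath 0 r) (at t within {0..1}))
        has_integral (2 * pi * \<i> * (\<Sum>i\<le>N. \<tau> i * of_real r ^ i * q i) + 2 * pi * \<i> * cnj (\<tau> 0)))
        {0..1}"
      by (simp add: has_contour_integral_def)
    then have "((\<lambda>t. Im (F (circlepath 0 r t) *
             vector_derivative (circlepath 0 r) (at t within {0..1})))
        has_integral Im (2 * pi * \<i> * (\<Sum>i\<le>N. \<tau> i * of_real r ^ i * q i) + 2 * pi * \<i> * cnj (\<tau> 0)))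
        {0..1}"
      by (rule has_integral_Im)
    then have "0 \<le> Im (2 * pi * \<i> * (\<Sum>i\<le>N. \<tau> i * of_real r ^ i * q i) + 2 * pi * \<i> * cnj (\<tau> 0))"
    proof (rule has_integral_nonneg)
      fix t :: real assume t: "t \<in> {0..1}"
      define e where "e = exp (2 * of_real pi * \<i> * of_real t)"
      define u where "u = of_real r * e"
      have e: "cmod e = 1" "e \<noteq> 0" "cnj e * e = 1"
        unfolding e_def by (auto simp: norm_exp_eq_Re exp_cnj simp flip: exp_add)
      have path: "circlepath 0 r t = u"
        by (simp add: circlepath u_def e_def)
      have deriv: "vector_derivative (circlepath 0 r) (at t within {0..1}) = 2 * pi * \<i> * u"
        using t by (simp add: vector_derivative_circlepath01 u_def e_def)
      have u: "u \<noteq> 0" "u \<in> ball 0 1" using r e by (auto simp: u_def norm_mult)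
      have re: "of_real r / u = cnj e" using r e by (simp add: u_def field_simps)
      have "F u * u = p u * (T (cnj e) + S u)"
      proof -
        have "(\<Sum>i\<le>N. \<tau> i * of_real r ^ i * (p u / u ^ Suc i)) * u = p u * T (cnj e)"
          unfolding T_def sum_distrib_left sum_distrib_right re[symmetric]
          using u by (intro sum.cong) (auto simp: power_divide field_simps)
        then show ?thesis using u by (simp add: F_def field_simps)
      qed
      moreover have "S u = cnj (T (cnj e))"
        using r by (simp add: S_def T_def u_def)
      ultimately have "F u * u = p u * of_real (2 * Re (T (cnj e)))"
        by (simp add: complex_add_cnj)
      then have "F u * (2 * pi * \<i> * u) = of_real (4 * pi * Re (T (cnj e))) * (\<i> * p u)"
        by (simp add: mult_ac)
      then have "Im (F u * (2 * pi * \<i> * u)) = Im (of_real (4 * pi * Re (T (cnj e))) * (\<i> * p u))"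
        by (rule arg_cong)
      also have "\<dots> = 4 * pi * Re (T (cnj e)) * Re (p u)" by simp
      finally have "Im (F u * (2 * pi * \<i> * u)) = 4 * pi * Re (T (cnj e)) * Re (p u)" .
      moreover have "0 \<le> Re (T (cnj e))" unfolding T_def by (rule nonneg) (simp add: e)
      ultimately show "0 \<le> Im (F (circlepath 0 r t) *
            vector_derivative (circlepath 0 r) (at t within {0..1}))"
        using pos[OF u(2)] by (simp add: path deriv)
    qed
    also have "\<dots> = 2 * pi * Re ((\<Sum>i\<le>N. \<tau> i * of_real r ^ i * q i) + cnj (\<tau> 0))"
      by (simp add: algebra_simps)
    finally have "0 \<le> Re ((\<Sum>i\<le>N. \<tau> i * of_real r ^ i * q i) + cnj (\<tau> 0))"
      by (rule zero_le_mult_pos) simp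
    also have "\<dots> = Re ((\<Sum>i\<le>N. \<tau> i * of_real r ^ i * q i) + \<tau> 0)" by simp
    also have "(\<Sum>i\<le>N. \<tau> i * of_real r ^ i * q i) + \<tau> 0 = 2 * (\<Sum>i\<le>N. \<tau> i * of_real r ^ i * c i)"
    proof -
      have "\<tau> i * of_real r ^ i * q i
          = 2 * (\<tau> i * of_real r ^ i * c i) - (if i = 0 then \<tau> 0 else 0)" for i
        by (simp add: q_def c_def p0)
      then show ?thesis by (simp add: sum_subtractf sum_distrib_left)
    qed
    finally show ?thesis by simp
  qed
  have "(\<lambda>l. inverse (real (l + 2))) \<longlonglongrightarrow> 0"
    using LIMSEQ_ignore_initial_segment[OF LIMSEQ_inverse_real_of_nat, of 1] by simp
  then have "(\<lambda>l. Re (\<Sum>i\<le>N. \<tau> i * of_real (1 - inverse (of_nat (l + 2))) ^ i * c i))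
      \<longlonglongrightarrow> Re (\<Sum>i\<le>N. \<tau> i * of_real (1 - 0) ^ i * c i)"
    by (intro tendsto_intros)
  then have "0 \<le> Re (\<Sum>i\<le>N. \<tau> i * of_real (1 - 0) ^ i * c i)"
    by (rule LIMSEQ_le_const) (intro exI[of _ 0] allI impI inner, auto simp: field_simps)
  then show "0 \<le> Re (\<Sum>i\<le>N. \<tau> i * (if i = 0 then 1 else (deriv ^^ i) p 0 / (2 * fact i)))"
    by (simp only: c_def diff_0_right of_real_1 power_one mult_1_right)
qed simp

section \<open>Beta mixtures of moment sequences\<close>

text \<open>
  Up to the normalisation \<open>Beta a b\<close>, these are the mixed moments of a Beta-distributed \<open>t\<close> and \<open>1 - t\<close>.
\<close>

lemma has_integral_beta_monomial:
  fixes a b :: real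
  assumes "0 < a" "0 < b"
  shows "((\<lambda>t. t powr (a - 1) * (1 - t) powr (b - 1) * (t ^ i * (1 - t) ^ j)) has_integral
           Beta a b * (pochhammer a i * pochhammer b j / pochhammer (a + b) (i + j))) {0..1}"
proof -
  have G: "pochhammer x n = Gamma (x + of_nat n) / Gamma x" "Gamma x > 0" if "x > 0" for x :: real and n
    using that by (auto intro!: pochhammer_Gamma elim!: nonpos_Ints_cases Gamma_real_pos)
  have nz: "Gamma a \<noteq> 0" "Gamma b \<noteq> 0" "Gamma (a + b) \<noteq> 0"
    using assms Gamma_real_pos[of a] Gamma_real_pos[of b] Gamma_real_pos[of "a + b"] by linarith+
  have Beta_shift: "Beta (a + i) (b + j)
      = Beta a b * (pochhammer a i * pochhammer b j / pochhammer (a + b) (i + j))"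
    using assms nz by (simp add: Beta_def G add_ac)
  have weight: "t powr (a + i - 1) * (1 - t) powr (b + j - 1)
      = t powr (a - 1) * (1 - t) powr (b - 1) * (t ^ i * (1 - t) ^ j)" if "t \<in> {0..1}" for t :: real
  proof -
    have "x powr (y + n - 1) = x powr (y - 1) * x ^ n" if "0 \<le> x" for x y :: real and n :: nat
      using that by (cases "x = 0") (auto simp: powr_realpow[symmetric] powr_add[symmetric] power_0_left algebra_simps)
    from this[of t a i] this[of "1 - t" b j] that show ?thesis by simp
  qed
  have "((\<lambda>t. t powr (a + i - 1) * (1 - t) powr (b + j - 1)) has_integral Beta (a + i) (b + j)) {0..1}"
    using assms by (intro has_integral_Beta_real) auto
  from has_integral_eq[OF weight this] show ?thesis unfolding Beta_shift .
qed

text \<open>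
  The probability that a beta-binomial variable with parameters \<open>a\<close>, \<open>b\<close> and \<open>i + j\<close> trials takes the
  value \<open>i\<close>.
\<close>

definition beta_binomial :: "real \<Rightarrow> real \<Rightarrow> nat \<Rightarrow> nat \<Rightarrow> real" where
  "beta_binomial a b i j =
     of_nat ((i + j) choose i) * (pochhammer a i * pochhammer b j / pochhammer (a + b) (i + j))"

text \<open>
  The weighted sum of \<open>x ^ i * y ^ (n - i)\<close> over \<open>i\<close> is the mean of \<open>(t * x + (1 - t) * y) ^ n\<close> for a
  Beta-distributed \<open>t\<close>. The point \<open>t * x + (1 - t) * y\<close> never leaves the disc, so the test polynomial
  stays nonnegative under the mean.
\<close>

lemma beta_binomial_mixture_nonneg:
  assumes ab: "0 < a" "0 < b"
    and nonneg: "\<And>x. cmod x \<le> 1 \<Longrightarrow> 0 \<le> Re (\<Sum>n\<le>N. \<tau> n * x ^ n)"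
    and x: "cmod x \<le> 1" and y: "cmod y \<le> 1"
  shows "0 \<le> Re (\<Sum>n\<le>N. \<Sum>i\<le>n. \<tau> n * of_real (beta_binomial a b i (n - i)) * x ^ i * y ^ (n - i))"
proof -
  define w where "w t = t powr (a - 1) * (1 - t) powr (b - 1)" for t
  define K where "K n i = Re (\<tau> n * x ^ i * y ^ (n - i)) * real (n choose i)" for n i
  have expand: "Re (\<Sum>n\<le>N. \<tau> n * (of_real t * x + of_real (1 - t) * y) ^ n)
      = (\<Sum>n\<le>N. \<Sum>i\<le>n. K n i * (t ^ i * (1 - t) ^ (n - i)))" for t
  proof -
    have "\<tau> n * (of_real t * x + of_real (1 - t) * y) ^ n
        = (\<Sum>i\<le>n. of_real (real (n choose i) * (t ^ i * (1 - t) ^ (n - i))) * (\<tau> n * x ^ i * y ^ (n - i)))"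
      for n
      unfolding binomial_ring sum_distrib_left
      by (intro sum.cong) (auto simp: power_mult_distrib mult_ac)
    moreover have "Re (of_real r * z) = r * Re z" for r z by simp
    ultimately show ?thesis
      by (simp only: Re_sum) (simp only: K_def mult_ac)
  qed
  have "((\<lambda>t. \<Sum>n\<le>N. \<Sum>i\<le>n. K n i * (w t * (t ^ i * (1 - t) ^ (n - i)))) has_integral
      (\<Sum>n\<le>N. \<Sum>i\<le>n. K n i * (Beta a b *
        (pochhammer a i * pochhammer b (n - i) / pochhammer (a + b) (i + (n - i)))))) {0..1}"
    unfolding w_def
    by (intro has_integral_sum has_integral_mult_right has_integral_beta_monomial ab) auto
  then have "0 \<le> (\<Sum>n\<le>N. \<Sum>i\<le>n. K n i * (Beta a b *
        (pochhammer a i * pochhammer b (n - i) / pochhammer (a + b) (i + (n - i)))))"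
  proof (rule has_integral_nonneg)
    fix t :: real assume t: "t \<in> {0..1}"
    have "cmod (of_real t * x + of_real (1 - t) * y) \<le> t * cmod x + (1 - t) * cmod y"
      by (rule norm_triangle_le) (use t in \<open>simp add: norm_mult del: of_real_diff\<close>)
    also have "\<dots> \<le> 1" using t x y by (intro convex_bound_le) auto
    finally have "0 \<le> w t * Re (\<Sum>n\<le>N. \<tau> n * (of_real t * x + of_real (1 - t) * y) ^ n)"
      by (intro mult_nonneg_nonneg nonneg) (simp_all add: w_def)
    then show "0 \<le> (\<Sum>n\<le>N. \<Sum>i\<le>n. K n i * (w t * (t ^ i * (1 - t) ^ (n - i))))"
      unfolding expand sum_distrib_left by (simp only: mult_ac)
  qed
  also have "\<dots> = Beta a b *
      Re (\<Sum>n\<le>N. \<Sum>i\<le>n. \<tau> n * of_real (beta_binomial a b i (n - i)) * x ^ i * y ^ (n - i))"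
  proof -
    have "K n i * (Beta a b *
        (pochhammer a i * pochhammer b (n - i) / pochhammer (a + b) (i + (n - i))))
      = Beta a b * Re (\<tau> n * of_real (beta_binomial a b i (n - i)) * x ^ i * y ^ (n - i))"
      if "i \<le> n" for n i
    proof -
      have "Re (\<tau> n * of_real (beta_binomial a b i (n - i)) * x ^ i * y ^ (n - i))
          = Re (of_real (beta_binomial a b i (n - i)) * (\<tau> n * x ^ i * y ^ (n - i)))"
        by (simp only: mult_ac)
      also have "\<dots> = beta_binomial a b i (n - i) * Re (\<tau> n * x ^ i * y ^ (n - i))"
        by simp
      finally show ?thesis
        using that by (simp only: K_def beta_binomial_def le_add_diff_inverse mult_ac)
    qed
    then show ?thesis by (simp add: sum_distrib_left del: times_complex.sel)
  qed
  finally have "0 \<le> Beta a b *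
      Re (\<Sum>n\<le>N. \<Sum>i\<le>n. \<tau> n * of_real (beta_binomial a b i (n - i)) * x ^ i * y ^ (n - i))" .
  moreover have "Beta a b > 0" using ab by (simp add: Beta_def Gamma_real_pos)
  ultimately show ?thesis by (rule zero_le_mult_pos)
qed

text \<open>
  For two points \<open>x\<close> and \<open>y\<close> of the disc this is the previous lemma. The condition to be tested is
  bilinear in the powers of \<open>x\<close> and \<open>y\<close>, so the powers of \<open>x\<close> can be replaced by \<open>u\<close> for each fixed
  \<open>y\<close>, and then the powers of \<open>y\<close> by \<open>v\<close>.
\<close>

lemma disc_moments_beta_convolution:
  assumes ab: "0 < a" "0 < b" and u: "u \<in> disc_moments" and v: "v \<in> disc_moments"
  shows "(\<lambda>n. \<Sum>i\<le>n. of_real (beta_binomial a b i (n - i)) * u i * v (n - i)) \<in> disc_moments"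
proof (rule disc_momentsI)
  show "(\<Sum>i\<le>0. of_real (beta_binomial a b i (0 - i)) * u i * v (0 - i)) = 1"
    by (simp add: beta_binomial_def disc_moments_0[OF u] disc_moments_0[OF v])
next
  fix N \<tau> assume nonneg: "\<And>x. cmod x \<le> 1 \<Longrightarrow> 0 \<le> Re (\<Sum>n\<le>N. \<tau> n * x ^ n)"
  \<comment> \<open>Padding the triangle \<open>i + j \<le> N\<close> with zeros to a square makes the two factors symmetric.\<close>
  define \<sigma> where "\<sigma> i j = (if i + j \<le> N then \<tau> (i + j) * of_real (beta_binomial a b i j) else 0)" for i j
  have square: "(\<Sum>n\<le>N. \<Sum>i\<le>n. \<tau> n * of_real (beta_binomial a b i (n - i)) * f i * g (n - i))
      = (\<Sum>i\<le>N. \<Sum>j\<le>N. \<sigma> i j * f i * g j)" for f g :: "nat \<Rightarrow> complex"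
  proof -
    have "(\<Sum>n\<le>N. \<Sum>i\<le>n. \<tau> n * of_real (beta_binomial a b i (n - i)) * f i * g (n - i))
        = (\<Sum>n\<le>N. \<Sum>i\<le>n. \<sigma> i (n - i) * f i * g (n - i))"
      by (intro sum.cong) (auto simp: \<sigma>_def)
    also have "\<dots> = (\<Sum>(i, j)\<in>{(i, j). i + j \<le> N}. \<sigma> i j * f i * g j)"
      by (rule sum.triangle_reindex_eq[symmetric])
    also have "\<dots> = (\<Sum>(i, j)\<in>{..N} \<times> {..N}. \<sigma> i j * f i * g j)"
      by (rule sum.mono_neutral_left) (auto simp: \<sigma>_def split: if_splits)
    finally show ?thesis by (simp add: sum.cartesian_product)
  qed
  have point_point: "0 \<le> Re (\<Sum>i\<le>N. \<Sum>j\<le>N. \<sigma> i j * x ^ i * y ^ j)"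
    if "cmod x \<le> 1" "cmod y \<le> 1" for x y
    using beta_binomial_mixture_nonneg[OF ab nonneg that] unfolding square[of "\<lambda>i. x ^ i" "\<lambda>j. y ^ j"] by simp
  have moment_point: "0 \<le> Re (\<Sum>j\<le>N. (\<Sum>i\<le>N. \<sigma> i j * u i) * y ^ j)" if y: "cmod y \<le> 1" for y
  proof -
    have swap: "(\<Sum>i\<le>N. (\<Sum>j\<le>N. \<sigma> i j * y ^ j) * f i) = (\<Sum>i\<le>N. \<Sum>j\<le>N. \<sigma> i j * f i * y ^ j)" for f
      unfolding sum_distrib_right by (simp only: mult_ac)
    have "0 \<le> Re (\<Sum>i\<le>N. (\<Sum>j\<le>N. \<sigma> i j * y ^ j) * u i)"
    proof (rule disc_moments_nonneg[OF u])
      fix x :: complex assume "cmod x \<le> 1"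
      then show "0 \<le> Re (\<Sum>i\<le>N. (\<Sum>j\<le>N. \<sigma> i j * y ^ j) * x ^ i)"
        unfolding swap using y by (rule point_point)
    qed
    also have "(\<Sum>i\<le>N. (\<Sum>j\<le>N. \<sigma> i j * y ^ j) * u i) = (\<Sum>j\<le>N. (\<Sum>i\<le>N. \<sigma> i j * u i) * y ^ j)"
      unfolding sum_distrib_right by (subst sum.swap) (simp only: mult_ac)
    finally show ?thesis .
  qed
  have "0 \<le> Re (\<Sum>j\<le>N. (\<Sum>i\<le>N. \<sigma> i j * u i) * v j)"
    by (rule disc_moments_nonneg[OF v moment_point])
  also have "(\<Sum>j\<le>N. (\<Sum>i\<le>N. \<sigma> i j * u i) * v j) = (\<Sum>i\<le>N. \<Sum>j\<le>N. \<sigma> i j * u i * v j)"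
    unfolding sum_distrib_right by (rule sum.swap)
  also have "\<dots> = (\<Sum>n\<le>N. \<tau> n * (\<Sum>i\<le>n. of_real (beta_binomial a b i (n - i)) * u i * v (n - i)))"
    unfolding square[symmetric] sum_distrib_left by (simp only: mult_ac)
  finally show "0 \<le> Re (\<Sum>n\<le>N. \<tau> n * (\<Sum>i\<le>n. of_real (beta_binomial a b i (n - i)) * u i * v (n - i)))" .
qed

section \<open>Products and exponentials of averaged binomial series\<close>

text \<open>
  For the moments \<open>u\<close> of a measure this is the average of the binomial series \<open>(1 - x * X)\<close> to the power
  \<open>- a\<close> over that measure, since the coefficients of the latter are \<open>pochhammer a n / fact n * x ^ n\<close>.
\<close>

definition pochhammer_fps :: "real \<Rightarrow> (nat \<Rightarrow> complex) \<Rightarrow> complex fps" where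
  "pochhammer_fps a u = Abs_fps (\<lambda>n. of_real (pochhammer a n / fact n) * u n)"

lemma pochhammer_fps_nth: "pochhammer_fps a u $ n = of_real (pochhammer a n / fact n) * u n"
  by (simp add: pochhammer_fps_def)

text \<open>
  Averages of powers \<open>- a\<close> and \<open>- b\<close> multiply to an average of powers \<open>- (a + b)\<close>: the coefficients of the
  product are exactly the beta-binomial mixtures.
\<close>

lemma pochhammer_fps_mult:
  assumes ab: "0 < a" "0 < b" and u: "u \<in> disc_moments" and v: "v \<in> disc_moments"
  shows "\<exists>w\<in>disc_moments. pochhammer_fps a u * pochhammer_fps b v = pochhammer_fps (a + b) w"
proof (rule bexI, rule fps_ext)
  define w where "w n = (\<Sum>i\<le>n. of_real (beta_binomial a b i (n - i)) * u i * v (n - i))" for n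
  show "w \<in> disc_moments"
    unfolding w_def by (rule disc_moments_beta_convolution[OF ab u v])
  fix n
  have "pochhammer a i / fact i * (pochhammer b (n - i) / fact (n - i))
      = pochhammer (a + b) n / fact n * beta_binomial a b i (n - i)" if "i \<le> n" for i
    using pochhammer_pos[of "a + b" n] ab that by (simp add: beta_binomial_def binomial_fact)
  then have weights: "complex_of_real (pochhammer a i / fact i) * of_real (pochhammer b (n - i) / fact (n - i))
      = of_real (pochhammer (a + b) n / fact n) * of_real (beta_binomial a b i (n - i))" if "i \<le> n" for i
    using that by (simp only: of_real_mult[symmetric])
  have "complex_of_real (pochhammer a i / fact i) * u i * (of_real (pochhammer b (n - i) / fact (n - i)) * v (n - i))
      = of_real (pochhammer (a + b) n / fact n) * (of_real (beta_binomial a b i (n - i)) * u i * v (n - i))"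
    if "i \<le> n" for i
    using weights[OF that] by algebra
  then show "(pochhammer_fps a u * pochhammer_fps b v) $ n = pochhammer_fps (a + b) w $ n"
    unfolding fps_mult_nth pochhammer_fps_nth w_def sum_distrib_left atMost_atLeast0
    by (intro sum.cong) auto
qed

lemma pochhammer_fps_power:
  assumes "0 < a" "u \<in> disc_moments"
  shows "\<exists>w\<in>disc_moments. pochhammer_fps a u ^ Suc k = pochhammer_fps (real (Suc k) * a) w"
proof (induction k)
  case 0
  then show ?case using assms by auto
next
  case (Suc k)
  then obtain w where w: "w \<in> disc_moments"
    and pw: "pochhammer_fps a u ^ Suc k = pochhammer_fps (real (Suc k) * a) w"
    by blast
  have "0 < real (Suc k) * a" using assms by simp
  from pochhammer_fps_mult[OF assms(1) this assms(2) w]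
  show ?case unfolding power_Suc[of _ "Suc k"] pw by (simp add: algebra_simps)
qed

text \<open>
  The coefficients of \<open>G = g ^ K\<close> can be read off from \<open>g * G' = K * g' * G\<close>, with no reference to
  \<open>K\<close>-fold products. This form survives the limit \<open>K \<rightarrow> \<infinity>\<close>.
\<close>

lemma fps_power_recurrence:
  fixes g :: "complex fps"
  assumes "g $ 0 = 1"
  shows "of_nat n * (g ^ Suc k) $ n
       = (\<Sum>i = 1..n. (of_nat (Suc k) * of_nat i - of_nat (n - i)) * g $ i * (g ^ Suc k) $ (n - i))"
proof -
  define G where "G = g ^ Suc k"
  have XD: "(fps_X * fps_deriv f) $ m = of_nat m * f $ m" for f :: "complex fps" and m
    by (simp add: fps_mult_fps_X_deriv_shift)
  have "fps_deriv G = fps_const (of_nat (Suc k)) * fps_deriv g * g ^ k"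
    unfolding G_def by (simp only: fps_deriv_power diff_Suc_1)
  then have "g * (fps_X * fps_deriv G) = fps_const (of_nat (Suc k)) * ((fps_X * fps_deriv g) * G)"
    unfolding G_def power_Suc by (simp only: mult_ac)
  then have "(g * (fps_X * fps_deriv G)) $ n = (fps_const (of_nat (Suc k)) * ((fps_X * fps_deriv g) * G)) $ n"
    by (rule arg_cong)
  then have "(\<Sum>i = 0..n. g $ i * (of_nat (n - i) * G $ (n - i)))
      = (\<Sum>i = 0..n. of_nat (Suc k) * (of_nat i * g $ i * G $ (n - i)))"
    unfolding fps_mult_nth[of g] fps_mult_left_const_nth fps_mult_nth[of "fps_X * _"] XD sum_distrib_left .
  then have "of_nat n * G $ n = (\<Sum>i = 1..n. of_nat (Suc k) * (of_nat i * g $ i * G $ (n - i)))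
       - (\<Sum>i = 1..n. g $ i * (of_nat (n - i) * G $ (n - i)))"
    by (simp add: sum.atLeast_Suc_atMost assms eq_diff_eq del: of_nat_Suc)
  also have "\<dots> = (\<Sum>i = 1..n. (of_nat (Suc k) * of_nat i - of_nat (n - i)) * g $ i * G $ (n - i))"
    unfolding sum_subtractf[symmetric] by (simp only: algebra_simps)
  finally show ?thesis unfolding G_def .
qed

text \<open>
  With \<open>\<epsilon> = s / K\<close> and \<open>\<epsilon> \<rightarrow> 0\<close> one has \<open>pochhammer \<epsilon> i / fact i = \<epsilon> / i + O(\<epsilon>\<^sup>2)\<close>, so \<open>K * i\<close> times
  this tends to \<open>s\<close>, while the term with the bounded factor \<open>d\<close> vanishes.
\<close>

lemma pochhammer_rate:
  fixes s :: real
  assumes "1 \<le> i"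
  shows "(\<lambda>k. (real (Suc k) * real i - d) * (pochhammer (s / real (Suc k)) i / fact i)) \<longlonglongrightarrow> s"
proof -
  obtain j where i: "i = Suc j" using assms by (cases i) auto
  have \<epsilon>: "(\<lambda>k. s / real (Suc k)) \<longlonglongrightarrow> 0"
    using tendsto_mult[OF tendsto_const[of s] LIMSEQ_inverse_real_of_nat] by (simp add: field_simps)
  have "(\<lambda>k. (s * real i - d * (s / real (Suc k))) * ((\<Prod>l<j. s / real (Suc k) + 1 + real l) / fact i))
      \<longlonglongrightarrow> (s * real i - d * 0) * ((\<Prod>l<j. 0 + 1 + real l) / fact i)"
    by (intro tendsto_intros \<epsilon>) simp
  also have "(\<Prod>l<j. 0 + 1 + real l) = fact j"
    by (simp add: fact_prod_Suc atLeast0LessThan)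
  also have "(s * real i - d * 0) * (fact j / fact i) = s"
    by (simp add: i del: of_nat_Suc)
  also have "(\<lambda>k. (s * real i - d * (s / real (Suc k))) * ((\<Prod>l<j. s / real (Suc k) + 1 + real l) / fact i))
      = (\<lambda>k. (real (Suc k) * real i - d) * (pochhammer (s / real (Suc k)) i / fact i))"
  proof
    fix k
    define \<epsilon> where "\<epsilon> = s / real (Suc k)"
    have "s = real (Suc k) * \<epsilon>" by (simp add: \<epsilon>_def)
    moreover have "pochhammer \<epsilon> i = \<epsilon> * (\<Prod>l<j. \<epsilon> + 1 + real l)"
      unfolding i pochhammer_rec by (simp add: pochhammer_prod atLeast0LessThan)
    ultimately show "(s * real i - d * (s / real (Suc k))) * ((\<Prod>l<j. s / real (Suc k) + 1 + real l) / fact i)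
        = (real (Suc k) * real i - d) * (pochhammer (s / real (Suc k)) i / fact i)"
      unfolding \<epsilon>_def[symmetric] by (simp add: algebra_simps del: of_nat_Suc)
  qed
  finally show ?thesis .
qed

text \<open>
  The recurrence is the coefficient form of \<open>X * H' = s * (p 1 * X + p 2 * X\<^sup>2 + \<dots>) * H\<close>, solved by
  \<open>exp (s * (p 1 * X + p 2 * X\<^sup>2 / 2 + \<dots>))\<close>. If \<open>p\<close> are the moments of a measure, the exponent is \<open>s\<close> times the
  average of \<open>- ln (1 - x * X)\<close>, so \<open>H\<close> is a continuous product of powers whose exponents add up to \<open>- s\<close>,
  and it should be an average of powers \<open>- s\<close>. To avoid the product integral, \<open>H\<close> is obtained as the limit
  of \<open>g ^ K\<close> where \<open>g\<close> is the average of \<open>(1 - x * X)\<close> to the power \<open>- s / K\<close>: each \<open>g ^ K\<close> is an average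
  of powers \<open>- s\<close>, and its recurrence tends to that of \<open>H\<close>.
\<close>

lemma disc_moments_exponential:
  assumes p: "p \<in> disc_moments" and s: "0 < s" and H0: "H 0 = 1"
    and rec: "\<And>n. 1 \<le> n \<Longrightarrow> of_nat n * H n = of_real s * (\<Sum>i = 1..n. p i * H (n - i))"
  shows "(\<lambda>n. H n / of_real (pochhammer s n / fact n)) \<in> disc_moments"
proof -
  define g where "g k = pochhammer_fps (s / real (Suc k)) p" for k
  have g0: "g k $ 0 = 1" for k by (simp add: g_def pochhammer_fps_nth disc_moments_0[OF p])
  have "\<exists>w\<in>disc_moments. g k ^ Suc k = pochhammer_fps s w" for k
    using pochhammer_fps_power[of "s / real (Suc k)" p k] s p
    by (simp add: g_def del: of_nat_Suc power_Suc)
  then obtain w where w: "\<And>k. w k \<in> disc_moments" and gw: "\<And>k. g k ^ Suc k = pochhammer_fps s (w k)"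
    by metis
  have lim: "(\<lambda>k. (g k ^ Suc k) $ n) \<longlonglongrightarrow> H n" for n
  proof (induction n rule: less_induct)
    case (less n)
    show ?case
    proof (cases "n = 0")
      case True
      then show ?thesis by (simp add: fps_power_zeroth g0 H0)
    next
      case False
      have "(\<lambda>k. of_real ((real (Suc k) * real i - real (n - i)) * (pochhammer (s / real (Suc k)) i / fact i))
              * p i * (g k ^ Suc k) $ (n - i)) \<longlonglongrightarrow> of_real s * p i * H (n - i)"
        if "i \<in> {1..n}" for i
        using that by (intro tendsto_intros pochhammer_rate less.IH) auto
      then have "(\<lambda>k. (\<Sum>i = 1..n. of_real ((real (Suc k) * real i - real (n - i)) *
              (pochhammer (s / real (Suc k)) i / fact i)) * p i * (g k ^ Suc k) $ (n - i)) / of_nat n)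
          \<longlonglongrightarrow> (\<Sum>i = 1..n. of_real s * p i * H (n - i)) / of_nat n"
        by (rule tendsto_divide[OF tendsto_sum tendsto_const]) (use False in \<open>auto simp only: of_nat_eq_0_iff\<close>)
      also have "(\<Sum>i = 1..n. of_real s * p i * H (n - i)) / of_nat n = H n"
        using rec[of n] False by (simp add: sum_distrib_left field_simps)
      also have "(\<lambda>k. (\<Sum>i = 1..n. of_real ((real (Suc k) * real i - real (n - i)) *
              (pochhammer (s / real (Suc k)) i / fact i)) * p i * (g k ^ Suc k) $ (n - i)) / of_nat n)
          = (\<lambda>k. (g k ^ Suc k) $ n)"
      proof
        fix k
        have "of_nat n * (g k ^ Suc k) $ n = (\<Sum>i = 1..n. of_real ((real (Suc k) * real i - real (n - i)) *
              (pochhammer (s / real (Suc k)) i / fact i)) * p i * (g k ^ Suc k) $ (n - i))"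
          unfolding fps_power_recurrence[OF g0] 
          by (intro sum.cong) (simp_all add: g_def pochhammer_fps_nth del: power_Suc of_nat_Suc)
        then show "(\<Sum>i = 1..n. of_real ((real (Suc k) * real i - real (n - i)) *
              (pochhammer (s / real (Suc k)) i / fact i)) * p i * (g k ^ Suc k) $ (n - i)) / of_nat n
          = (g k ^ Suc k) $ n"
          using False by (simp add: field_simps del: power_Suc of_nat_Suc)
      qed
      finally show ?thesis .
    qed
  qed
  show ?thesis
  proof (rule disc_moments_limit[OF w])
    fix n
    have nz: "pochhammer s n / fact n \<noteq> 0" using pochhammer_pos[OF s, of n] by simp
    have "w k n = (g k ^ Suc k) $ n / of_real (pochhammer s n / fact n)" for k
      unfolding gw pochhammer_fps_nth using nz by (simp del: of_real_divide)
    moreover have "(\<lambda>k. (g k ^ Suc k) $ n / of_real (pochhammer s n / fact n))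
        \<longlonglongrightarrow> H n / of_real (pochhammer s n / fact n)"
      using nz by (intro tendsto_intros lim) (simp del: of_real_divide)
    ultimately show "(\<lambda>k. w k n) \<longlonglongrightarrow> H n / of_real (pochhammer s n / fact n)" by simp
  qed
qed

section \<open>Taylor coefficients on the class and its hull\<close>

lemma holomorphic_disc_has_fps_expansion:
  assumes "f holomorphic_on ball 0 1"
  shows "f has_fps_expansion fps_expansion f 0"
  using assms by (intro has_fps_expansion_fps_expansion[of "ball 0 1"]) auto

lemma fps_expansion_deriv_nth:
  "fps_expansion (deriv f) z $ n = of_nat (n + 1) * fps_expansion f z $ (n + 1)"
  by (simp add: fps_expansion_def funpow_Suc_right del: funpow.simps of_nat_Suc)

lemma has_expansion_imp_fps_expansion:
  assumes "has_expansion f a"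
  shows "fps_expansion f 0 = Abs_fps (\<lambda>n. if n = 0 then 0 else if n = 1 then 1 else a n)"
proof (rule fps_expansion_eqI)
  define b where "b n = (if n = 0 then 0 else if n = 1 then 1 else a n)" for n
  have "(\<lambda>n. b n * z ^ n) sums f z" if z: "z \<in> ball 0 1" for z
  proof -
    have "(\<lambda>n. b (n + 2) * z ^ (n + 2)) sums (f z - z)"
      using assms z by (simp add: has_expansion_def b_def)
    then have "(\<lambda>n. b n * z ^ n) sums (f z - z + (\<Sum>i<2. b i * z ^ i))"
      by (subst (asm) sums_iff_shift) simp
    then show ?thesis by (simp add: b_def numeral_2_eq_2)
  qed
  then have "\<forall>\<^sub>F z in nhds 0. (\<lambda>n. b n * z ^ n) sums f z"
    by (intro eventually_nhds_in_open[of "ball 0 1", THEN eventually_mono]) auto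
  then show "f has_fps_expansion Abs_fps b"
    by (intro has_fps_expansionI) simp
qed

lemma has_expansion_fps_expansion:
  assumes holo: "f holomorphic_on ball 0 1" and f0: "f 0 = 0" "deriv f 0 = 1"
  shows "has_expansion f (fps_nth (fps_expansion f 0))"
  unfolding has_expansion_def
proof
  fix z :: complex assume z: "z \<in> ball 0 1"
  have "(\<lambda>n. fps_expansion f 0 $ n * z ^ n) sums f z"
    by (rule has_fps_expansion_imp_sums_complex[where r = 1])
       (use z holo in \<open>auto intro!: holomorphic_disc_has_fps_expansion simp: one_ereal_def\<close>)
  then have "(\<lambda>n. fps_expansion f 0 $ (n + 2) * z ^ (n + 2)) sums
      (f z - (\<Sum>i<2. fps_expansion f 0 $ i * z ^ i))"
    by (subst sums_iff_shift) simp
  then show "(\<lambda>n. fps_expansion f 0 $ (n + 2) * z ^ (n + 2)) sums (f z - z)"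
    by (simp add: numeral_2_eq_2 fps_expansion_def f0)
qed

text \<open>
  The coefficients of \<open>f'\<close> divided by those of \<open>(1 - z) powr (- 2 * (1 - \<alpha>))\<close>, the derivative of the
  extremal function.
\<close>

definition normalised_coeff :: "real \<Rightarrow> (complex \<Rightarrow> complex) \<Rightarrow> nat \<Rightarrow> complex" where
  "normalised_coeff \<alpha> f n =
     of_nat (n + 1) * fps_expansion f 0 $ (n + 1) / of_real (pochhammer (2 * (1 - \<alpha>)) n / fact n)"

lemma class_K_holomorphic: "f \<in> class_K \<alpha> \<Longrightarrow> f holomorphic_on ball 0 1"
  by (simp add: class_K_def class_A_def)

text \<open>
  The function \<open>p = (1 + z * f'' / f' - \<alpha>) / (1 - \<alpha>)\<close> has positive real part and value \<open>1\<close> at \<open>0\<close>, so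
  beyond the constant term its coefficients are twice the moments \<open>c\<close> of a measure. Solving for \<open>f''\<close> gives \<open>z * f'' = (1 - \<alpha>) * (p - 1) * f'\<close>, which is the
  differential equation of the exponential with \<open>s = 2 * (1 - \<alpha>)\<close>.
\<close>

lemma class_K_disc_moments:
  assumes \<alpha>: "\<alpha> < 1" and f: "f \<in> class_K \<alpha>"
  shows "normalised_coeff \<alpha> f \<in> disc_moments"
proof -
  define p where "p z = (1 + z * deriv (deriv f) z / deriv f z - of_real \<alpha>) / of_real (1 - \<alpha>)" for z
  define c where "c n = (if n = 0 then 1 else (deriv ^^ n) p 0 / (2 * fact n))" for n
  define H where "H = fps_expansion (deriv f) 0"
  define P where "P = fps_expansion p 0"
  have holo: "f holomorphic_on ball 0 1" using f by (rule class_K_holomorphic)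
  then have holo': "deriv f holomorphic_on ball 0 1" "deriv (deriv f) holomorphic_on ball 0 1"
    by (auto intro!: holomorphic_deriv)
  have f': "deriv f z \<noteq> 0" "Re (1 + z * deriv (deriv f) z / deriv f z) > \<alpha>" if "z \<in> ball 0 1" for z
    using f that by (auto simp: class_K_def)
  have holop: "p holomorphic_on ball 0 1"
    unfolding p_def using \<alpha> f'(1) by (intro holomorphic_intros holo') auto
  have Rep: "0 \<le> Re (p z)" if "z \<in> ball 0 1" for z
    using f'(2)[OF that] \<alpha> by (simp add: p_def Re_divide_of_real del: of_real_diff)
  have \<alpha>': "complex_of_real \<alpha> \<noteq> 1" using \<alpha> by simp
  then have p0: "p 0 = 1" by (simp add: p_def)
  have c: "c \<in> disc_moments"
    unfolding c_def by (rule caratheodory_disc_moments[OF holop Rep p0])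
  have "deriv f 0 = 1"
  proof -
    obtain a where "has_expansion f a" using f by (auto simp: class_K_def class_A_def)
    from has_expansion_imp_fps_expansion[OF this]
    have "fps_expansion f 0 $ 1 = 1" by simp
    then show ?thesis by (simp add: fps_expansion_def)
  qed
  then have H0: "H $ 0 = 1" by (simp add: H_def fps_expansion_def)
  have ode: "fps_X * fps_deriv H = fps_const (of_real (1 - \<alpha>)) * ((P - 1) * H)"
  proof (rule fps_expansion_unique_complex)
    show "(\<lambda>z. z * deriv (deriv f) z) has_fps_expansion fps_X * fps_deriv H"
      unfolding H_def
      by (intro fps_expansion_intros holomorphic_disc_has_fps_expansion holo')
    have "(\<lambda>z. of_real (1 - \<alpha>) * ((p z - 1) * deriv f z))
        has_fps_expansion fps_const (of_real (1 - \<alpha>)) * ((P - 1) * H)"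
      unfolding H_def P_def
      by (intro fps_expansion_intros holomorphic_disc_has_fps_expansion holo' holop)
    moreover have "of_real (1 - \<alpha>) * ((p z - 1) * deriv f z) = z * deriv (deriv f) z"
      if "z \<in> ball 0 1" for z
    proof -
      have "of_real (1 - \<alpha>) * p z = 1 + z * deriv (deriv f) z / deriv f z - of_real \<alpha>"
        using \<alpha>' by (simp add: p_def)
      then have "of_real (1 - \<alpha>) * (p z - 1) = z * deriv (deriv f) z / deriv f z"
        by (simp add: right_diff_distrib)
      then show ?thesis using f'(1)[OF that] by (simp add: mult.assoc[symmetric])
    qed
    then have "\<forall>\<^sub>F z in nhds 0. of_real (1 - \<alpha>) * ((p z - 1) * deriv f z) = z * deriv (deriv f) z"
      by (intro eventually_nhds_in_open[of "ball 0 1", THEN eventually_mono]) auto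
    ultimately show "(\<lambda>z. z * deriv (deriv f) z)
        has_fps_expansion fps_const (of_real (1 - \<alpha>)) * ((P - 1) * H)"
      by (subst (asm) has_fps_expansion_cong[OF _ refl])
  qed
  have rec: "of_nat n * H $ n = of_real (2 * (1 - \<alpha>)) * (\<Sum>i = 1..n. c i * H $ (n - i))" for n
  proof -
    have P: "(P - 1) $ i = (if i = 0 then 0 else 2 * c i)" for i
      by (simp add: P_def c_def fps_expansion_def p0)
    have "(fps_X * fps_deriv H) $ n = (fps_const (of_real (1 - \<alpha>)) * ((P - 1) * H)) $ n"
      by (simp only: ode)
    then have "of_nat n * H $ n = of_real (1 - \<alpha>) * (\<Sum>i = 0..n. (if i = 0 then 0 else 2 * c i) * H $ (n - i))"
      unfolding fps_mult_left_const_nth fps_mult_nth[of "P - 1"] P fps_mult_fps_X_deriv_shift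
      by simp
    also have "(\<Sum>i = 0..n. (if i = 0 then 0 else 2 * c i) * H $ (n - i)) = 2 * (\<Sum>i = 1..n. c i * H $ (n - i))"
      by (simp add: sum.atLeast_Suc_atMost sum_distrib_left mult.assoc)
    finally show ?thesis by simp
  qed
  have "(\<lambda>n. H $ n / of_real (pochhammer (2 * (1 - \<alpha>)) n / fact n)) \<in> disc_moments"
    by (rule disc_moments_exponential[OF c _ H0 rec]) (use \<alpha> in simp)
  moreover have "normalised_coeff \<alpha> f = (\<lambda>n. H $ n / of_real (pochhammer (2 * (1 - \<alpha>)) n / fact n))"
    unfolding normalised_coeff_def H_def fps_expansion_deriv_nth ..
  ultimately show ?thesis by simp
qed

lemma fun_convex_hull_disc_moments:
  assumes \<alpha>: "\<alpha> < 1" and g: "g \<in> fun_convex_hull (class_K \<alpha>)"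
  shows "normalised_coeff \<alpha> g \<in> disc_moments"
proof -
  from g obtain k :: nat and t :: "nat \<Rightarrow> real" and h :: "nat \<Rightarrow> complex \<Rightarrow> complex"
    where g_eq: "g = (\<lambda>z. \<Sum>i<k. of_real (t i) * h i z)"
    and th: "\<forall>i<k. 0 \<le> t i \<and> h i \<in> class_K \<alpha>" and t1: "(\<Sum>i<k. t i) = (1::real)"
    unfolding fun_convex_hull_def mem_Collect_eq by (elim exE conjE) (rule that)
  then have t: "\<And>i. i < k \<Longrightarrow> 0 \<le> t i" and h: "\<And>i. i < k \<Longrightarrow> h i \<in> class_K \<alpha>" by auto
  have "fps_expansion g 0 = (\<Sum>i<k. fps_const (of_real (t i)) * fps_expansion (h i) 0)"
    unfolding g_eq
    by (intro fps_expansion_eqI fps_expansion_intros holomorphic_disc_has_fps_expansion class_K_holomorphic[OF h]) auto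
  then have "normalised_coeff \<alpha> g = (\<lambda>n. \<Sum>i<k. of_real (t i) * normalised_coeff \<alpha> (h i) n)"
    by (simp add: normalised_coeff_def fun_eq_iff fps_sum_nth sum_distrib_left sum_divide_distrib mult_ac)
  moreover have "(\<lambda>n. \<Sum>i<k. of_real (t i) * normalised_coeff \<alpha> (h i) n) \<in> disc_moments"
    by (rule disc_moments_convex[where c = "\<lambda>i. normalised_coeff \<alpha> (h i)"])
       (use t t1 class_K_disc_moments[OF \<alpha> h] in auto)
  ultimately show ?thesis by simp
qed

lemma class_HK_holomorphic:
  assumes "f \<in> class_HK \<alpha>"
  shows "f holomorphic_on ball 0 1"
proof -
  have "f \<in> topspace compact_convergence"
    using assms by (simp add: class_HK_def in_closure_of)
  then show ?thesis unfolding compact_convergence_def by auto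
qed

lemma class_HK_approx:
  assumes f: "f \<in> class_HK \<alpha>" and e: "0 < e"
  shows "\<exists>g\<in>fun_convex_hull (class_K \<alpha>). g holomorphic_on ball 0 1 \<and>
           (\<forall>z\<in>cball 0 (1/2). dist (g z) (f z) < e)"
proof -
  define U where "U = {g. g holomorphic_on ball 0 1 \<and> (\<forall>z\<in>cball 0 (1/2). dist (g z) (f z) < e)}"
  note holo = class_HK_holomorphic[OF f]
  have "openin compact_convergence U"
    unfolding compact_convergence_def U_def
    by (rule topology_generated_by_Basis, rule CollectI)
       (use holo e in \<open>intro exI[of _ f] exI[of _ "cball 0 (1/2)"] exI[of _ e], auto\<close>)
  moreover have "f \<in> U" using holo e by (simp add: U_def)
  ultimately obtain g where "g \<in> fun_convex_hull (class_K \<alpha>)" "g \<in> U"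
    using f by (auto simp: class_HK_def in_closure_of)
  then show ?thesis by (auto simp: U_def)
qed

lemma fps_expansion_diff_bound:
  assumes f: "f holomorphic_on ball 0 1" and g: "g holomorphic_on ball 0 1"
    and close: "\<And>z. z \<in> cball 0 (1/2) \<Longrightarrow> dist (g z) (f z) < e"
  shows "cmod (fps_expansion g 0 $ n - fps_expansion f 0 $ n) \<le> e * 2 ^ n"
proof -
  have "fps_expansion (\<lambda>z. g z - f z) 0 = fps_expansion g 0 - fps_expansion f 0"
    by (intro fps_expansion_eqI fps_expansion_intros holomorphic_disc_has_fps_expansion f g)
  then have "fps_expansion g 0 $ n - fps_expansion f 0 $ n = fps_expansion (\<lambda>z. g z - f z) 0 $ n"
    by simp
  moreover have "cmod ((deriv ^^ n) (\<lambda>z. g z - f z) 0) \<le> fact n * e / (1 / 2) ^ n"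
  proof (rule Cauchy_inequality)
    have "(\<lambda>z. g z - f z) holomorphic_on ball 0 1" by (intro holomorphic_intros f g)
    then show "(\<lambda>z. g z - f z) holomorphic_on ball 0 (1/2)" "continuous_on (cball 0 (1/2)) (\<lambda>z. g z - f z)"
      by (auto intro!: holomorphic_on_imp_continuous_on elim!: holomorphic_on_subset)
    show "cmod (g x - f x) \<le> e" if "cmod (0 - x) = 1 / 2" for x
      using close[of x] that by (simp add: dist_norm)
  qed simp
  ultimately show ?thesis
    by (simp add: fps_expansion_def norm_divide power_divide field_simps)
qed

text \<open>
  Functions of the hull approximating \<open>f\<close> uniformly on \<open>cball 0 (1/2)\<close> have Taylor coefficients converging to
  those of \<open>f\<close>, by Cauchy's inequality, and moment sequences are closed under such limits.
\<close>

lemma class_HK_disc_moments: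
  assumes \<alpha>: "\<alpha> < 1" and f: "f \<in> class_HK \<alpha>"
  shows "normalised_coeff \<alpha> f \<in> disc_moments"
proof -
  have "\<forall>l. \<exists>g. g \<in> fun_convex_hull (class_K \<alpha>) \<and> g holomorphic_on ball 0 1 \<and>
      (\<forall>z\<in>cball 0 (1/2). dist (g z) (f z) < inverse (real (Suc l)))"
    using class_HK_approx[OF f] by (metis inverse_positive_iff_positive of_nat_0_less_iff zero_less_Suc)
  from choice[OF this] obtain g where
    g: "\<And>l. g l \<in> fun_convex_hull (class_K \<alpha>)" "\<And>l. g l holomorphic_on ball 0 1"
    and close: "\<And>l z. z \<in> cball 0 (1/2) \<Longrightarrow> dist (g l z) (f z) < inverse (real (Suc l))"
    by blast
  have coeff: "(\<lambda>l. fps_expansion (g l) 0 $ n) \<longlonglongrightarrow> fps_expansion f 0 $ n" for n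
  proof (rule LIM_zero_cancel, rule Lim_null_comparison)
    show "\<forall>\<^sub>F l in sequentially. cmod (fps_expansion (g l) 0 $ n - fps_expansion f 0 $ n)
        \<le> inverse (real (Suc l)) * 2 ^ n"
      by (intro always_eventually allI fps_expansion_diff_bound class_HK_holomorphic[OF f] g close)
    show "(\<lambda>l. inverse (real (Suc l)) * 2 ^ n) \<longlonglongrightarrow> 0"
      using tendsto_mult[OF LIMSEQ_inverse_real_of_nat tendsto_const[of "2 ^ n"]] by simp
  qed
  show ?thesis
  proof (rule disc_moments_limit[OF fun_convex_hull_disc_moments[OF \<alpha> g(1)]])
    fix n
    have "pochhammer (2 * (1 - \<alpha>)) n > 0" using \<alpha> by (intro pochhammer_pos) simp
    then show "(\<lambda>l. normalised_coeff \<alpha> (g l) n) \<longlonglongrightarrow> normalised_coeff \<alpha> f n"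
      unfolding normalised_coeff_def by (intro tendsto_intros coeff) simp
  qed
qed

section \<open>The extremal functions\<close>

lemma f2_has_field_derivative:
  assumes "cmod w < 1"
  shows "(f2 \<alpha> has_field_derivative (1 - w) powr (- of_real (2 * (1 - \<alpha>)))) (at w)"
proof -
  have slit: "1 - w \<notin> \<real>\<^sub>\<le>\<^sub>0"
    using assms complex_Re_le_cmod[of w] by (auto simp: complex_nonpos_Reals_iff)
  show ?thesis
  proof (cases "\<alpha> = 1 / 2")
    case True
    have "((\<lambda>z. - Ln (1 - z)) has_field_derivative inverse (1 - w)) (at w)"
      using slit by (auto intro!: derivative_eq_intros)
    moreover have "2 * (1 - \<alpha>) = 1" using True by simp
    then have "inverse (1 - w) = (1 - w) powr (- of_real (2 * (1 - \<alpha>)))"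
      using slit by (auto simp only: of_real_1 powr_def) (simp_all add: exp_minus)
    moreover have "f2 \<alpha> = (\<lambda>z. - Ln (1 - z))" using True by (simp add: f2_def fun_eq_iff)
    ultimately show ?thesis by simp
  next
    case False
    define c where "c = complex_of_real (1 - 2 * \<alpha>)"
    have c: "c \<noteq> 0" using False unfolding c_def of_real_eq_0_iff by simp
    have "((\<lambda>z. ((1 - z) powr (- c) - 1) / c) has_field_derivative (1 - w) powr (- c - 1)) (at w)"
      using slit c by (auto intro!: derivative_eq_intros has_field_derivative_powr simp: field_simps)
    moreover have "- c - 1 = - of_real (2 * (1 - \<alpha>))" by (simp add: c_def)
    moreover have "f2 \<alpha> = (\<lambda>z. ((1 - z) powr (- c) - 1) / c)"
      using False by (simp add: f2_def c_def fun_eq_iff)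
    ultimately show ?thesis by simp
  qed
qed

lemma rotation_f2_has_field_derivative:
  assumes "cmod z < 1"
  shows "(rotation \<theta> (f2 \<alpha>) has_field_derivative
           (1 - exp (\<i> * of_real \<theta>) * z) powr (- of_real (2 * (1 - \<alpha>)))) (at z)"
proof -
  define x where "x = exp (\<i> * of_real \<theta>)"
  have x: "cmod x = 1" "exp (- \<i> * of_real \<theta>) * x = 1"
    by (auto simp: x_def norm_exp_eq_Re simp flip: exp_add)
  have "((\<lambda>z. exp (- \<i> * of_real \<theta>) * f2 \<alpha> (x * z)) has_field_derivative
      exp (- \<i> * of_real \<theta>) * ((1 - x * z) powr (- of_real (2 * (1 - \<alpha>))) * x)) (at z)"
    using assms x
    by (intro DERIV_cmult DERIV_chain2[of "f2 \<alpha>"] f2_has_field_derivative)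
       (auto simp: norm_mult intro!: derivative_eq_intros)
  moreover have "exp (- \<i> * of_real \<theta>) * (y * x) = y" for y
    using x by (metis mult.left_commute mult.right_neutral)
  moreover have "rotation \<theta> (f2 \<alpha>) = (\<lambda>z. exp (- \<i> * of_real \<theta>) * f2 \<alpha> (x * z))"
    by (simp add: rotation_def x_def fun_eq_iff)
  ultimately show ?thesis by (simp only: x_def[symmetric])
qed

lemma rotation_f2_holomorphic: "rotation \<theta> (f2 \<alpha>) holomorphic_on ball 0 1"
  by (rule holomorphic_onI)
     (auto intro: has_field_derivative_at_within rotation_f2_has_field_derivative
        simp: field_differentiable_def intro!: exI)

lemma rotation_f2_has_expansion:
  "has_expansion (rotation \<theta> (f2 \<alpha>)) (fps_nth (fps_expansion (rotation \<theta> (f2 \<alpha>)) 0))"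
proof (rule has_expansion_fps_expansion[OF rotation_f2_holomorphic])
  show "rotation \<theta> (f2 \<alpha>) 0 = 0" by (simp add: rotation_def f2_def)
  show "deriv (rotation \<theta> (f2 \<alpha>)) 0 = 1"
    using DERIV_imp_deriv[OF rotation_f2_has_field_derivative[of 0 \<theta> \<alpha>]] by simp
qed

text \<open>
  The map \<open>w \<mapsto> 1 / (1 - w)\<close> sends the unit disc to the half-plane \<open>Re > 1 / 2\<close>.
\<close>

lemma Re_divide_one_minus:
  assumes "cmod w < 1"
  shows "Re (w / (1 - w)) > - (1 / 2)"
proof -
  have w: "1 - w \<noteq> 0" using assms by auto
  have "(cmod w)\<^sup>2 < 1" using assms by (simp add: power_less_one_iff abs_square_less_1)
  then have "(cmod (1 - w))\<^sup>2 < 2 * Re (1 - w)"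
    unfolding cmod_power2 by (simp add: power2_eq_square algebra_simps)
  then have "1 / 2 < Re (1 - w) / (cmod (1 - w))\<^sup>2"
    using w by (simp add: pos_less_divide_eq del: minus_complex.sel)
  moreover have "Re (1 / (1 - w)) = Re (1 - w) / (cmod (1 - w))\<^sup>2"
    by (simp add: Re_divide cmod_power2)
  ultimately have "Re (1 / (1 - w)) > 1 / 2"
    by simp
  moreover have "w / (1 - w) = 1 / (1 - w) - 1" using w by (simp add: field_simps)
  ultimately show ?thesis by simp
qed

text \<open>
  With \<open>x = exp (\<i> * \<theta>)\<close> and \<open>w = x * z\<close>, the rotated function satisfies
  \<open>1 + z * g'' / g' = 1 + 2 * (1 - \<alpha>) * w / (1 - w)\<close>, whose real part exceeds \<open>1 - (1 - \<alpha>) = \<alpha>\<close>.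
\<close>

lemma rotation_f2_class_K:
  assumes \<alpha>: "\<alpha> < 1"
  shows "rotation \<theta> (f2 \<alpha>) \<in> class_K \<alpha>"
proof -
  define x where "x = exp (\<i> * of_real \<theta>)"
  define s where "s = complex_of_real (2 * (1 - \<alpha>))"
  define g where "g = rotation \<theta> (f2 \<alpha>)"
  have x: "cmod x = 1" by (simp add: x_def norm_exp_eq_Re)
  have Re_scale: "Re (of_real r * v) = r * Re v" for r v by simp
  have g': "deriv g z = (1 - x * z) powr (- s)" if "z \<in> ball 0 1" for z
    unfolding g_def x_def s_def using that by (intro DERIV_imp_deriv rotation_f2_has_field_derivative) simp
  have "deriv g z \<noteq> 0 \<and> Re (1 + z * deriv (deriv g) z / deriv g z) > \<alpha>" if z: "z \<in> ball 0 1" for z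
  proof
    have xz: "cmod (x * z) < 1" using z x by (simp add: norm_mult)
    then have nz: "1 - x * z \<noteq> 0" by auto
    have slit: "1 - x * z \<notin> \<real>\<^sub>\<le>\<^sub>0"
      using xz complex_Re_le_cmod[of "x * z"] by (auto simp: complex_nonpos_Reals_iff)
    show nz': "deriv g z \<noteq> 0" using g'[OF z] nz by (simp add: powr_def)
    have "((\<lambda>z. (1 - x * z) powr (- s)) has_field_derivative s * x * (1 - x * z) powr (- s - 1)) (at z)"
      using slit by (auto intro!: derivative_eq_intros has_field_derivative_powr simp: algebra_simps)
    then have "(deriv g has_field_derivative s * x * (1 - x * z) powr (- s - 1)) (at z)"
      by (rule has_field_derivative_transform_within_open[of _ _ _ "ball 0 1"]) (use z g' in auto)
    then have "deriv (deriv g) z = s * x * (1 - x * z) powr (- s - 1)" by (rule DERIV_imp_deriv)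
    also have "\<dots> = s * x * deriv g z / (1 - x * z)"
      using nz by (simp add: g'[OF z] powr_diff)
    finally have "z * deriv (deriv g) z / deriv g z = s * ((x * z) / (1 - x * z))"
      using nz' by (simp add: mult_ac)
    then have "Re (1 + z * deriv (deriv g) z / deriv g z) = 1 + 2 * (1 - \<alpha>) * Re ((x * z) / (1 - x * z))"
      by (simp only: s_def plus_complex.sel one_complex.sel Re_scale)
    moreover have "2 * (1 - \<alpha>) * Re ((x * z) / (1 - x * z)) > 2 * (1 - \<alpha>) * (- (1 / 2))"
      using \<alpha> by (intro mult_strict_left_mono Re_divide_one_minus xz) simp
    moreover have "2 * (1 - \<alpha>) * (- (1 / 2)) = \<alpha> - 1" by (simp add: field_simps)
    ultimately show "Re (1 + z * deriv (deriv g) z / deriv g z) > \<alpha>" by linarith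
  qed
  moreover have "g \<in> class_A"
    unfolding class_A_def g_def using rotation_f2_holomorphic rotation_f2_has_expansion by blast
  ultimately show ?thesis by (simp add: class_K_def g_def)
qed

lemma class_K_subset_class_HK: "class_K \<alpha> \<subseteq> class_HK \<alpha>"
proof -
  have hull: "f \<in> fun_convex_hull (class_K \<alpha>)" if "f \<in> class_K \<alpha>" for f
    unfolding fun_convex_hull_def using that
    by (intro CollectI exI[of _ "1::nat"] exI[of _ "\<lambda>_. 1::real"] exI[of _ "\<lambda>_. f"]) simp
  have space: "f \<in> topspace compact_convergence" if "f \<in> class_K \<alpha>" for f
  proof -
    define U where "U = {g. g holomorphic_on ball 0 1 \<and> (\<forall>z\<in>{}. dist (g z) (f z) < (1::real))}"
    have "openin compact_convergence U"
      unfolding compact_convergence_def U_def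
      by (rule topology_generated_by_Basis, rule CollectI)
         (use class_K_holomorphic[OF that] in \<open>intro exI[of _ f] exI[of _ "{}"] exI[of _ 1], auto\<close>)
    moreover have "f \<in> U" using class_K_holomorphic[OF that] by (simp add: U_def)
    ultimately show ?thesis by (auto simp: topspace_def)
  qed
  show ?thesis
  proof
    fix f assume f: "f \<in> class_K \<alpha>"
    show "f \<in> class_HK \<alpha>"
      unfolding class_HK_def in_closure_of using hull[OF f] space[OF f] by blast
  qed
qed

text \<open>
  The derivative of the rotated function is the single kernel \<open>(1 - x * z) powr (- s)\<close> with
  \<open>x = exp (\<i> * \<theta>)\<close> and \<open>s = 2 * (1 - \<alpha>)\<close>, so the measure is the unit mass at \<open>x\<close>.
\<close>

lemma normalised_coeff_rotation_f2:
  assumes \<alpha>: "\<alpha> < 1"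
  shows "normalised_coeff \<alpha> (rotation \<theta> (f2 \<alpha>)) n = exp (\<i> * of_real \<theta>) ^ n"
proof -
  define x where "x = exp (\<i> * of_real \<theta>)"
  define s where "s = 2 * (1 - \<alpha>)"
  have x: "cmod x = 1" by (simp add: x_def norm_exp_eq_Re)
  have s: "pochhammer s n > 0" using \<alpha> by (intro pochhammer_pos) (simp add: s_def)
  have "fps_expansion (deriv (rotation \<theta> (f2 \<alpha>))) 0
      = Abs_fps (\<lambda>n. of_real (pochhammer s n / fact n) * x ^ n)"
  proof (rule fps_expansion_eqI, rule has_fps_expansionI)
    have "(\<lambda>n. of_real (pochhammer s n / fact n) * x ^ n * z ^ n) sums deriv (rotation \<theta> (f2 \<alpha>)) z"
      if z: "z \<in> ball 0 1" for z
    proof -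
      have "(\<lambda>n. (- of_real s gchoose n) * (- (x * z)) ^ n) sums (1 + - (x * z)) powr (- of_real s)"
        by (rule gen_binomial_complex) (use z x in \<open>simp add: norm_mult\<close>)
      moreover have "(- of_real s gchoose n) * (- (x * z)) ^ n = of_real (pochhammer s n / fact n) * x ^ n * z ^ n" for n
      proof -
        have "(- 1) ^ n * (- (x * z)) ^ n = x ^ n * z ^ n"
          by (simp flip: power_mult_distrib)
        then show ?thesis
          by (simp add: gbinomial_pochhammer pochhammer_of_real[symmetric] mult_ac)
      qed
      moreover have "deriv (rotation \<theta> (f2 \<alpha>)) z = (1 + - (x * z)) powr (- of_real s)"
        using DERIV_imp_deriv[OF rotation_f2_has_field_derivative[of z \<theta> \<alpha>]] z by (simp add: x_def s_def)
      ultimately show ?thesis by simp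
    qed
    then show "\<forall>\<^sub>F z in nhds 0. (\<lambda>n. Abs_fps (\<lambda>n. of_real (pochhammer s n / fact n) * x ^ n) $ n * z ^ n)
        sums deriv (rotation \<theta> (f2 \<alpha>)) z"
      by (intro eventually_nhds_in_open[of "ball 0 1", THEN eventually_mono]) auto
  qed
  from this[THEN arg_cong[where f = "\<lambda>F. F $ n"]]
  have "of_nat (n + 1) * fps_expansion (rotation \<theta> (f2 \<alpha>)) 0 $ (n + 1) = of_real (pochhammer s n / fact n) * x ^ n"
    unfolding fps_expansion_deriv_nth by simp
  then show ?thesis
    unfolding normalised_coeff_def s_def[symmetric] x_def[symmetric] using s by (simp del: of_nat_Suc)
qed

section \<open>The generalised Zalcman inequality\<close>

lemma A_coeff_pochhammer: "A_coeff \<alpha> n = pochhammer (2 * (1 - \<alpha>)) (n - 1) / fact (n - 1)"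
  by (simp add: A_coeff_def pochhammer_prod atLeast0LessThan)

lemma A_coeff_pos: "\<alpha> < 1 \<Longrightarrow> 0 < A_coeff \<alpha> n"
  by (simp add: A_coeff_pochhammer pochhammer_pos)

lemma has_expansion_coeff:
  assumes "\<alpha> < 1" and "has_expansion f a" and "2 \<le> n"
  shows "a n = of_real (A_coeff \<alpha> n / real n) * normalised_coeff \<alpha> f (n - 1)"
proof -
  have "fps_expansion f 0 $ n = a n"
    using has_expansion_imp_fps_expansion[OF assms(2)] assms(3) by simp
  moreover have "n - 1 + 1 = n" using assms(3) by simp
  ultimately have "normalised_coeff \<alpha> f (n - 1) = of_nat n * a n / of_real (A_coeff \<alpha> n)"
    by (simp only: normalised_coeff_def A_coeff_pochhammer)
  then show ?thesis using A_coeff_pos[OF assms(1), of n] assms(3) by simp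
qed

theorem corollary2p3:
  fixes \<alpha> \<mu> :: real and n m :: nat
  assumes "\<alpha> < 1" and "n \<ge> 2" and "m \<ge> 2"
  shows
    "(\<forall>f a. f \<in> class_HK \<alpha> \<longrightarrow> has_expansion f a \<longrightarrow>
        cmod (of_real \<mu> * a n * a m - a (n + m - 1)) \<le>
          (if 0 \<le> \<mu> \<and> \<mu> \<le> 2 * real n * real m * A_coeff \<alpha> (n + m - 1) /
                              (real (n + m - 1) * A_coeff \<alpha> n * A_coeff \<alpha> m)
           then A_coeff \<alpha> (n + m - 1) / real (n + m - 1)
           else \<bar>\<mu> * (A_coeff \<alpha> n * A_coeff \<alpha> m / (real n * real m))
                  - A_coeff \<alpha> (n + m - 1) / real (n + m - 1)\<bar>)) \<and>
     (\<forall>\<theta>. rotation \<theta> (f2 \<alpha>) \<in> class_HK \<alpha> \<and>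
        (\<exists>a. has_expansion (rotation \<theta> (f2 \<alpha>)) a \<and>
          (\<not> (0 \<le> \<mu> \<and> \<mu> \<le> 2 * real n * real m * A_coeff \<alpha> (n + m - 1) /
                              (real (n + m - 1) * A_coeff \<alpha> n * A_coeff \<alpha> m)) \<longrightarrow>
           cmod (of_real \<mu> * a n * a m - a (n + m - 1)) =
             \<bar>\<mu> * (A_coeff \<alpha> n * A_coeff \<alpha> m / (real n * real m))
               - A_coeff \<alpha> (n + m - 1) / real (n + m - 1)\<bar>)))"
proof -
  define j k where "j = n - 1" and "k = m - 1"
  \<comment> \<open>With \<open>X\<close>, \<open>Y\<close> and \<open>\<nu>\<close> the functional becomes \<open>- Y * (c (j + k) - \<nu> * c j * c k)\<close> in the moments \<open>c\<close>, and
    the threshold for \<open>\<mu>\<close> becomes \<open>\<nu> \<le> 2\<close>, which is where \<open>max 1 \<bar>1 - \<nu>\<bar>\<close> changes its form.\<close>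
  define X where "X = A_coeff \<alpha> n * A_coeff \<alpha> m / (real n * real m)"
  define Y where "Y = A_coeff \<alpha> (n + m - 1) / real (n + m - 1)"
  define \<nu> where "\<nu> = \<mu> * X / Y"
  have jk: "n + m - 1 - 1 = j + k" "n + m - 1 \<ge> 2" using assms by (auto simp: j_def k_def)
  have XY: "0 < X" "0 < Y"
    using assms A_coeff_pos[OF assms(1)] jk by (auto simp: X_def Y_def)
  have threshold: "2 * real n * real m * A_coeff \<alpha> (n + m - 1) /
      (real (n + m - 1) * A_coeff \<alpha> n * A_coeff \<alpha> m) = 2 * Y / X"
    by (simp add: X_def Y_def mult_ac)
  have range: "0 \<le> \<mu> \<and> \<mu> \<le> 2 * Y / X \<longleftrightarrow> 0 \<le> \<nu> \<and> \<nu> \<le> 2"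
    using XY by (simp add: \<nu>_def field_simps zero_le_mult_iff)
  have abs_eq: "\<bar>\<mu> * X - Y\<bar> = Y * \<bar>1 - \<nu>\<bar>"
  proof -
    have "\<mu> * X - Y = Y * (\<nu> - 1)" using XY by (simp add: \<nu>_def field_simps)
    then show ?thesis using XY by (simp add: abs_mult abs_minus_commute)
  qed
  have bound_eq: "(if 0 \<le> \<mu> \<and> \<mu> \<le> 2 * Y / X then Y else \<bar>\<mu> * X - Y\<bar>) = Y * max 1 \<bar>1 - \<nu>\<bar>"
    unfolding range abs_eq using XY by (auto simp: max_def)
  have functional: "of_real \<mu> * a n * a m - a (n + m - 1)
      = - of_real Y * (normalised_coeff \<alpha> f (j + k)
           - of_real \<nu> * normalised_coeff \<alpha> f j * normalised_coeff \<alpha> f k)"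
    if "has_expansion f a" for f a
  proof -
    have "\<mu> * (A_coeff \<alpha> n / real n) * (A_coeff \<alpha> m / real m) = Y * \<nu>"
      using XY by (simp add: \<nu>_def X_def)
    then have "of_real \<mu> * complex_of_real (A_coeff \<alpha> n / real n) * of_real (A_coeff \<alpha> m / real m)
        = of_real Y * of_real \<nu>"
      by (simp only: of_real_mult[symmetric])
    then show ?thesis
      unfolding has_expansion_coeff[OF assms(1) that assms(2)] has_expansion_coeff[OF assms(1) that assms(3)]
        has_expansion_coeff[OF assms(1) that jk(2)] jk(1) j_def[symmetric] k_def[symmetric] Y_def[symmetric]
      by algebra
  qed
  have bound: "cmod (of_real \<mu> * a n * a m - a (n + m - 1)) \<le> Y * max 1 \<bar>1 - \<nu>\<bar>"
    if f: "f \<in> class_HK \<alpha>" and a: "has_expansion f a" for f a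
    unfolding functional[OF a] norm_mult
    using disc_moments_product_bound[OF class_HK_disc_moments[OF assms(1) f], of j k \<nu>] XY
    by (simp add: mult_left_mono)
  have sharp: "cmod (of_real \<mu> * a n * a m - a (n + m - 1)) = Y * \<bar>1 - \<nu>\<bar>"
    if a: "has_expansion (rotation \<theta> (f2 \<alpha>)) a" for \<theta> a
  proof -
    define x where "x = exp (\<i> * complex_of_real \<theta>)"
    \<comment> \<open>For a unit mass the powers combine, \<open>x ^ j * x ^ k = x ^ (j + k)\<close>, and only the scalar \<open>1 - \<nu>\<close> is left.\<close>
    have "of_real \<mu> * a n * a m - a (n + m - 1) = - of_real Y * (of_real (1 - \<nu>) * x ^ (j + k))"
      unfolding functional[OF a] normalised_coeff_rotation_f2[OF assms(1)] x_def[symmetric]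
      by (simp add: power_add algebra_simps)
    moreover have "cmod x = 1" by (simp add: x_def norm_exp_eq_Re)
    ultimately show ?thesis
      using XY by (simp add: norm_mult norm_power del: of_real_diff)
  qed
  have in_HK: "rotation \<theta> (f2 \<alpha>) \<in> class_HK \<alpha>" for \<theta>
    using rotation_f2_class_K[OF assms(1)] class_K_subset_class_HK by blast
  show ?thesis
    unfolding threshold X_def[symmetric] Y_def[symmetric]
  proof (intro conjI allI impI)
    fix f a assume "f \<in> class_HK \<alpha>" "has_expansion f a"
    then show "cmod (of_real \<mu> * a n * a m - a (n + m - 1))
        \<le> (if 0 \<le> \<mu> \<and> \<mu> \<le> 2 * Y / X then Y else \<bar>\<mu> * X - Y\<bar>)"
      unfolding bound_eq by (rule bound)
  next
    fix \<theta>
    show "rotation \<theta> (f2 \<alpha>) \<in> class_HK \<alpha>" by (rule in_HK)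
    show "\<exists>a. has_expansion (rotation \<theta> (f2 \<alpha>)) a \<and>
        (\<not> (0 \<le> \<mu> \<and> \<mu> \<le> 2 * Y / X) \<longrightarrow>
          cmod (of_real \<mu> * a n * a m - a (n + m - 1)) = \<bar>\<mu> * X - Y\<bar>)"
      unfolding abs_eq using sharp rotation_f2_has_expansion by blast
  qed
qed

end
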